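(* Let $X$ be a finite-dimensional inner product space over $\mathbb{R}$ (real case) or over $\mathbb{C}$ with Hermitian product (complex case). Let $L\subset X$ be a line and let $X=V_1\oplus\cdots\oplus V_k$ be an orthogonal partition of $X$. Given any Lebesgue measurable set $S\subset L$, let $S_j$ be its orthogonal projection on $V_j$. Then \begin{itemize} \item in the real case, $|S|_1^2 = \sum_{j=1}^k |S_j|_1^2$; \item in the complex case, $|S|_2 = \sum_{j=1}^k |S_j|_2$. \end{itemize}
   Context: Subspaces, dimension and orthogonality are taken over the same field as $X$. A line is a $1$-dimensional subspace over the field of $X$ (so in the complex case it is a complex line, of real dimension $2$). An orthogonal partition of $X$ is a collection $\{V_1,\ldots,V_k\}$ of mutually orthogonal subspaces with $X=V_1\oplus\cdots\oplus V_k$. A complex space is also regarded as a real inner product space with inner product $\operatorname{Re}\langle\cdot,\cdot\rangle$. On any real or complex subspace $U\subset X$, $|\cdot|_m$ denotes the $m$-dimensional Lebesgue measure of $U$ if $m=\dim_{\mathbb{R}} U$, and $|\cdot|_m=0$ if $m>\dim_{\mathbb{R}}U$. The measure of a projected set $S_j$ is taken in the subspace which is the orthogonal projection of $L$ on $V_j$. *)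

theory Defs
  imports "HOL-Analysis.Analysis"
begin

section \<open>Finite-dimensional complex inner product spaces\<close>

text \<open>
  The Hermitian product is linear in its first argument.  The underlying real inner product
  is its real part; together with conjugate symmetry this makes
  \<open>cinner x x\<close> equal to the positive definite \<open>x \<bullet> x\<close>, so positive definiteness is not
  a separate axiom.  Likewise \<open>1 *\<^sub>C x = x\<close> follows from \<open>scaleR_scaleC\<close>.  Class
  \<^class>\<open>euclidean_space\<close> excludes only the zero space, which contains no line.
\<close>

class complex_euclidean_space = euclidean_space +
  fixes scaleC :: "complex \<Rightarrow> 'a \<Rightarrow> 'a"  (infixr \<open>*\<^sub>C\<close> 75)
    and cinner :: "'a \<Rightarrow> 'a \<Rightarrow> complex"
  assumes scaleC_add_right: "c *\<^sub>C (x + y) = c *\<^sub>C x + c *\<^sub>C y"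
    and scaleC_add_left: "(c + d) *\<^sub>C x = c *\<^sub>C x + d *\<^sub>C x"
    and scaleC_scaleC: "c *\<^sub>C d *\<^sub>C x = (c * d) *\<^sub>C x"
    and scaleR_scaleC: "r *\<^sub>R x = complex_of_real r *\<^sub>C x"
    and cinner_commute: "cinner x y = cnj (cinner y x)"
    and cinner_add_left: "cinner (x + y) z = cinner x z + cinner y z"
    and cinner_scaleC_left: "cinner (c *\<^sub>C x) y = c * cinner x y"
    and inner_eq_Re_cinner: "x \<bullet> y = Re (cinner x y)"

global_interpretation complex_vector:
  vector_space "scaleC :: complex \<Rightarrow> 'a \<Rightarrow> 'a::complex_euclidean_space"
proof
  fix x :: 'a
  show "1 *\<^sub>C x = x"
    using scaleR_scaleC[of 1 x] by simp
qed (simp_all add: scaleC_add_right scaleC_add_left scaleC_scaleC)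

lemma cinner_self:
  fixes x :: "'a::complex_euclidean_space"
  shows "cinner x x = complex_of_real (x \<bullet> x)"
proof -
  have "Im (cinner x x) = 0"
    using cinner_commute[of x x] by (simp add: complex_eq_iff)
  then show ?thesis
    by (simp add: complex_eq_iff inner_eq_Re_cinner)
qed

instantiation complex :: complex_euclidean_space
begin

definition scaleC_complex :: "complex \<Rightarrow> complex \<Rightarrow> complex"
  where "scaleC_complex = (*)"

definition cinner_complex :: "complex \<Rightarrow> complex \<Rightarrow> complex"
  where "cinner_complex x y = x * cnj y"

instance
  by standard
    (simp_all add: scaleC_complex_def cinner_complex_def algebra_simps scaleR_conv_of_real
      inner_complex_def)

end

instantiation vec :: (complex_euclidean_space, finite) complex_euclidean_space
begin

definition scaleC_vec :: "complex \<Rightarrow> 'a ^ 'b \<Rightarrow> 'a ^ 'b"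
  where "scaleC_vec c x = (\<chi> i. c *\<^sub>C x $ i)"

definition cinner_vec :: "'a ^ 'b \<Rightarrow> 'a ^ 'b \<Rightarrow> complex"
  where "cinner_vec x y = (\<Sum>i\<in>UNIV. cinner (x $ i) (y $ i))"

instance
proof
  fix c d :: complex and r :: real and x y z :: "'a ^ 'b"
  show "c *\<^sub>C (x + y) = c *\<^sub>C x + c *\<^sub>C y"
    by (simp add: scaleC_vec_def vec_eq_iff scaleC_add_right)
  show "(c + d) *\<^sub>C x = c *\<^sub>C x + d *\<^sub>C x"
    by (simp add: scaleC_vec_def vec_eq_iff scaleC_add_left)
  show "c *\<^sub>C d *\<^sub>C x = (c * d) *\<^sub>C x"
    by (simp add: scaleC_vec_def vec_eq_iff scaleC_scaleC)
  show "r *\<^sub>R x = complex_of_real r *\<^sub>C x"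
    by (simp add: scaleC_vec_def vec_eq_iff scaleR_scaleC)
  show "cinner x y = cnj (cinner y x)"
    unfolding cinner_vec_def cnj_sum by (intro sum.cong refl cinner_commute)
  show "cinner (x + y) z = cinner x z + cinner y z"
    by (simp add: cinner_vec_def cinner_add_left sum.distrib)
  show "cinner (c *\<^sub>C x) y = c * cinner x y"
    by (simp add: cinner_vec_def scaleC_vec_def cinner_scaleC_left sum_distrib_left)
  show "x \<bullet> y = Re (cinner x y)"
    by (simp add: cinner_vec_def inner_vec_def inner_eq_Re_cinner)
qed

end


section \<open>Lebesgue measure on a subspace\<close>

definition orthonormal_basis :: "'a::euclidean_space set \<Rightarrow> 'a set \<Rightarrow> bool"
  where "orthonormal_basis U B \<longleftrightarrow>
    pairwise orthogonal B \<and> (\<forall>b\<in>B. norm b = 1) \<and> span B = U"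

lemma orthonormal_basis_exists:
  fixes U :: "'a::euclidean_space set"
  assumes "subspace U"
  shows "\<exists>B. orthonormal_basis U B"
  using orthonormal_basis_subspace[OF assms] unfolding orthonormal_basis_def by metis

text \<open>
  The construction of \<^const>\<open>lborel\<close> with \<^const>\<open>Basis\<close> replaced by an orthonormal basis
  of the real subspace \<open>U\<close>.  The choice of the basis is immaterial because Lebesgue
  measure is invariant under orthogonal maps.
\<close>

definition lborel_subspace :: "'a::euclidean_space set \<Rightarrow> 'a measure"
  where "lborel_subspace U =
    (let B = (SOME B. orthonormal_basis U B)
     in distr (\<Pi>\<^sub>M b\<in>B. lborel) (restrict_space borel U) (\<lambda>x. \<Sum>b\<in>B. x b *\<^sub>R b))"

definition lebesgue_subspace :: "'a::euclidean_space set \<Rightarrow> 'a measure"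
  where "lebesgue_subspace U = completion (lborel_subspace U)"

lemma space_lebesgue_subspace [simp]: "space (lebesgue_subspace U) = U"
  by (simp add: lebesgue_subspace_def lborel_subspace_def Let_def space_restrict_space)

text \<open>
  \<open>|S|\<^sub>m\<close> for \<open>S \<subseteq> U\<close>, with values in \<open>[0, \<infinity>]\<close>.  Here \<^const>\<open>dim\<close> is the real dimension,
  also when \<open>U\<close> is a complex subspace.  Only \<open>m \<ge> dim U\<close> is meaningful; the value is \<open>0\<close>
  for \<open>m > dim U\<close> by convention.
\<close>

definition subspace_vol :: "nat \<Rightarrow> 'a::euclidean_space set \<Rightarrow> 'a set \<Rightarrow> ennreal"
  where "subspace_vol m U S = (if m = dim U then emeasure (lebesgue_subspace U) S else 0)"


section \<open>Lines, projections and orthogonal partitions\<close>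

definition real_line :: "'a::euclidean_space set \<Rightarrow> bool"
  where "real_line L \<longleftrightarrow> subspace L \<and> dim L = 1"

definition complex_line :: "'a::complex_euclidean_space set \<Rightarrow> bool"
  where "complex_line L \<longleftrightarrow> complex_vector.subspace L \<and> complex_vector.dim L = 1"

definition real_orth_proj :: "'a::euclidean_space set \<Rightarrow> 'a \<Rightarrow> 'a"
  where "real_orth_proj V x = (THE y. y \<in> V \<and> (\<forall>v\<in>V. (x - y) \<bullet> v = 0))"

definition complex_orth_proj :: "'a::complex_euclidean_space set \<Rightarrow> 'a \<Rightarrow> 'a"
  where "complex_orth_proj V x = (THE y. y \<in> V \<and> (\<forall>v\<in>V. cinner (x - y) v = 0))"

text \<open>
  The last conjunct of both definitions says that the whole space is the (internal) direct
  sum of \<open>V 1, \<dots>, V k\<close>.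
\<close>

definition real_orth_partition :: "nat \<Rightarrow> (nat \<Rightarrow> 'a::euclidean_space set) \<Rightarrow> bool"
  where "real_orth_partition k V \<longleftrightarrow>
    (\<forall>j\<in>{1..k}. subspace (V j)) \<and>
    (\<forall>i\<in>{1..k}. \<forall>j\<in>{1..k}. i \<noteq> j \<longrightarrow> (\<forall>x\<in>V i. \<forall>y\<in>V j. x \<bullet> y = 0)) \<and>
    (\<forall>x. \<exists>!v. v \<in> Pi\<^sub>E {1..k} V \<and> x = (\<Sum>j=1..k. v j))"

definition complex_orth_partition :: "nat \<Rightarrow> (nat \<Rightarrow> 'a::complex_euclidean_space set) \<Rightarrow> bool"
  where "complex_orth_partition k V \<longleftrightarrow>
    (\<forall>j\<in>{1..k}. complex_vector.subspace (V j)) \<and>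
    (\<forall>i\<in>{1..k}. \<forall>j\<in>{1..k}. i \<noteq> j \<longrightarrow> (\<forall>x\<in>V i. \<forall>y\<in>V j. cinner x y = 0)) \<and>
    (\<forall>x. \<exists>!v. v \<in> Pi\<^sub>E {1..k} V \<and> x = (\<Sum>j=1..k. v j))"

end

theory Submission
  imports Defs
begin

text \<open>
  Let \<open>n\<close> be the real dimension of the line \<open>L\<close>: \<open>1\<close> in the real case and \<open>2\<close> in the complex
  case.  A unit vector \<open>u\<close> of \<open>L\<close> gives a linear isometry \<open>g\<close> of \<open>\<real>\<^sup>n\<close> onto \<open>L\<close>, namely
  multiplication of \<open>u\<close> by a real or complex scalar.  An orthogonal projection \<open>P\<close> commutes with
  scalars, so \<open>P \<circ> g\<close> multiplies \<open>P u\<close> by the same scalar; it is linear and scales all norms by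
  \<open>norm (P u)\<close>.  Hence \<open>P\<close> multiplies the \<open>n\<close>-dimensional measure on \<open>L\<close> by \<open>norm (P u) ^ n\<close>
  (\<open>subspace_vol_image_projection\<close>); when \<open>P u = 0\<close>, both sides vanish, since then \<open>P ` L\<close> has
  dimension \<open>0 < n\<close>.  In the real case this is squared, so that in both cases the \<open>j\<close>-th term of
  the sum is the left-hand side times \<open>(norm (P\<^sub>j u))\<^sup>2\<close>.  These squares sum to
  \<open>(norm u)\<^sup>2 = 1\<close> by Pythagoras (\<open>sum_norm_real_orth_proj\<close>).

  The measure-theoretic part is that Lebesgue measure on a subspace, defined through an arbitrary
  orthonormal basis, is carried over by every linear isometry from \<open>\<real>\<^sup>n\<close>
  (\<open>lborel_subspace_eq_distr\<close>); this comes down to the invariance of Lebesgue measure on \<open>\<real>\<^sup>n\<close>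
  under orthogonal maps.
\<close>

section \<open>Lebesgue measure on a subspace and linear isometries\<close>

lemma inj_linear_isometry:
  assumes "linear g" "\<And>x. norm (g x) = norm x"
  shows "inj g"
  using assms(2) by (intro linear_injective_0[OF assms(1), THEN iffD2]) (metis norm_eq_zero)

lemma borel_measurable_linear_euclidean:
  fixes f :: "'c::euclidean_space \<Rightarrow> 'd::euclidean_space"
  assumes "linear f"
  shows "f \<in> borel_measurable borel"
  using assms by (auto intro!: borel_measurable_continuous_onI linear_continuous_on
      simp: linear_conv_bounded_linear)

text \<open>
  The index type is well-ordered only because \<open>measure_orthogonal_image\<close> is stated so.
\<close>

lemma lborel_distr_orthogonal_transformation:
  fixes f :: "real^'n::{finite,wellorder} \<Rightarrow> real^'n::_"
  assumes "orthogonal_transformation f"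
  shows "distr lborel borel f = lborel"
proof (rule lborel_eqI[symmetric])
  fix l u :: "real^'n::_"
  assume le: "\<And>b. b \<in> Basis \<Longrightarrow> l \<bullet> b \<le> u \<bullet> b"
  have bij: "bij f" and orth: "orthogonal_transformation (inv f)"
    using assms by (auto intro: orthogonal_transformation_bij orthogonal_transformation_inv)
  have f: "f \<in> lborel \<rightarrow>\<^sub>M borel"
    using borel_measurable_linear_euclidean[OF orthogonal_transformation_linear[OF assms]] by simp
  have "emeasure (distr lborel borel f) (box l u) = emeasure lborel (f -` box l u)"
    using f by (simp add: emeasure_distr)
  also have "\<dots> = emeasure lebesgue (f -` box l u)"
    using measurable_sets[OF f, of "box l u"] by simp
  also have "f -` box l u = inv f ` box l u"
    using bij by (rule bij_vimage_eq_inv_image)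
  also have "emeasure lebesgue (inv f ` box l u) = ennreal (measure lebesgue (inv f ` box l u))"
    using measurable_orthogonal_image[OF orth lmeasurable_box] by (rule emeasure_eq_measure2)
  also have "\<dots> = ennreal (measure lebesgue (box l u))"
    by (simp add: measure_orthogonal_image orth)
  also have "\<dots> = (\<Prod>b\<in>Basis. (u - l) \<bullet> b)"
    using le by (simp add: measure_lborel_box)
  finally show "emeasure (distr lborel borel f) (box l u) = (\<Prod>b\<in>Basis. (u - l) \<bullet> b)" .
qed simp

text \<open>
  Lebesgue measure is the product of its one-dimensional coordinates for any indexing of
  \<^const>\<open>Basis\<close>; below, the index set is an orthonormal basis of a subspace of another space.
\<close>

lemma distr_lborel_coordinates:
  fixes h :: "'i \<Rightarrow> 'c::euclidean_space"
  assumes h: "bij_betw h B Basis"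
  shows "distr lborel (\<Pi>\<^sub>M b\<in>B. lborel) (\<lambda>x. \<lambda>b\<in>B. x \<bullet> h b) = (\<Pi>\<^sub>M b\<in>B. lborel)"
proof -
  interpret product_sigma_finite "\<lambda>b::'i. lborel :: real measure" by standard
  let ?C = "\<lambda>x. \<lambda>b\<in>B. x \<bullet> h b"
  have fin: "finite B"
    using bij_betw_finite[OF h] by simp
  have C: "?C \<in> lborel \<rightarrow>\<^sub>M (\<Pi>\<^sub>M b\<in>B. lborel)"
    by (intro measurable_restrict) simp
  show ?thesis
  proof (rule PiM_eqI)
    fix A :: "'i \<Rightarrow> real set"
    assume A: "\<And>b. b \<in> B \<Longrightarrow> A b \<in> sets lborel"
    define A' where "A' b = A (inv_into B h b)" for b
    have A': "A' b \<in> sets borel" if "b \<in> Basis" for b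
      using A h that by (auto simp: A'_def bij_betw_def inv_into_into)
    have hA: "A' (h b) = A b" if "b \<in> B" for b
      using h that by (simp add: A'_def bij_betw_def inv_into_f_f)
    have box: "{x. \<forall>b\<in>B. x \<bullet> h b \<in> A b} = {x. \<forall>b\<in>Basis. x \<bullet> b \<in> A' b}"
      using hA by (simp flip: bij_betw_imp_surj_on[OF h])
    have pre: "?C -` Pi\<^sub>E B A \<inter> space lborel = {x. \<forall>b\<in>B. x \<bullet> h b \<in> A b}"
      by (auto simp: PiE_iff)
    have PA: "Pi\<^sub>E B A \<in> sets (\<Pi>\<^sub>M b\<in>B. lborel)"
      using A fin by (intro sets_PiM_I_finite) auto
    have "emeasure (distr lborel (\<Pi>\<^sub>M b\<in>B. lborel) ?C) (Pi\<^sub>E B A)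
        = emeasure lborel {x. \<forall>b\<in>Basis. x \<bullet> b \<in> A' b}"
      using emeasure_distr[OF C PA] unfolding pre box .
    also have "\<dots> = (\<integral>\<^sup>+x. indicator {x. \<forall>b\<in>Basis. x \<bullet> b \<in> A' b} x \<partial>lborel)"
      using measurable_sets[OF C PA] unfolding pre box by simp
    also have "\<dots> = (\<integral>\<^sup>+x. (\<Prod>b\<in>Basis. indicator (A' b) (x \<bullet> b)) \<partial>lborel)"
      by (intro nn_integral_cong) (auto simp: indicator_def)
    also have "\<dots> = (\<Prod>b\<in>Basis. emeasure lborel (A' b))"
      using A' by (subst nn_integral_lborel_prod) auto
    also have "\<dots> = (\<Prod>b\<in>B. emeasure lborel (A b))"
      using prod.reindex_bij_betw[OF h, of "\<lambda>b. emeasure lborel (A' b)"] hA by simp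
    finally show "emeasure (distr lborel (\<Pi>\<^sub>M b\<in>B. lborel) ?C) (Pi\<^sub>E B A)
        = (\<Prod>b\<in>B. emeasure lborel (A b))" .
  qed (use fin in simp_all)
qed

lemma orthonormal_basis_facts:
  assumes "orthonormal_basis U B"
  shows "finite B" "independent B" "card B = dim U" "subspace U"
    "\<And>a b. a \<in> B \<Longrightarrow> b \<in> B \<Longrightarrow> a \<bullet> b = (if a = b then 1 else 0)"
    "\<And>x. x \<in> U \<Longrightarrow> (\<Sum>b\<in>B. (x \<bullet> b) *\<^sub>R b) = x"
proof -
  have B: "pairwise orthogonal B" "\<And>b. b \<in> B \<Longrightarrow> norm b = 1" "span B = U"
    using assms by (auto simp: orthonormal_basis_def)
  then have "0 \<notin> B" by fastforce
  with B(1) show ind: "independent B"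
    by (rule pairwise_orthogonal_independent)
  then show fin: "finite B"
    by (rule independent_imp_finite)
  show "card B = dim U"
    using ind B(3) dim_eq_card_independent dim_span by metis
  show "subspace U"
    using B(3) subspace_span by blast
  show ip: "a \<bullet> b = (if a = b then 1 else 0)" if "a \<in> B" "b \<in> B" for a b
    using B(1,2) that by (auto simp: pairwise_def orthogonal_def norm_eq_1)
  fix x assume "x \<in> U"
  then obtain c where c: "x = (\<Sum>b\<in>B. c b *\<^sub>R b)"
    using B(3) fin by (auto simp: span_finite)
  have "x \<bullet> b = c b" if "b \<in> B" for b
    using that fin by (simp add: c inner_sum_left ip if_distrib sum.delta cong: if_cong)
  then show "(\<Sum>b\<in>B. (x \<bullet> b) *\<^sub>R b) = x"
    by (simp add: c)
qed

text \<open>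
  The definition of \<^const>\<open>lborel_subspace\<close> amounts to transporting Lebesgue measure along the
  isometry \<open>e\<close> that sends the standard basis to the chosen orthonormal basis.  Any other isometry
  \<open>g\<close> with the same range is \<open>e \<circ> Q\<close> with \<open>Q\<close> orthogonal, and \<open>Q\<close> preserves Lebesgue measure.
\<close>

lemma lborel_subspace_eq_distr:
  fixes g :: "real^'n::{finite,wellorder} \<Rightarrow> 'a::euclidean_space"
  assumes lin: "linear g" and iso: "\<And>x. norm (g x) = norm x"
  shows "lborel_subspace (range g) = distr lborel (restrict_space borel (range g)) g"
proof -
  let ?U = "range g"
  let ?R = "restrict_space borel ?U :: 'a measure"
  define B where "B = (SOME B. orthonormal_basis ?U B)"
  have sub: "subspace ?U"
    using lin by (simp add: linear_subspace_image)
  have ob: "orthonormal_basis ?U B"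
    unfolding B_def using someI_ex[OF orthonormal_basis_exists[OF sub]] .
  note B = orthonormal_basis_facts[OF ob]
  have "inj g"
    using lin iso by (rule inj_linear_isometry)
  then have "card B = card (Basis :: (real^'n::_) set)"
    using B(3) dim_image_eq[OF lin, of UNIV] by simp
  then obtain h :: "'a \<Rightarrow> real^'n::_" where h: "bij_betw h B Basis"
    using B(1) finite_same_card_bij finite_Basis by blast
  define e where "e x = (\<Sum>b\<in>B. (x \<bullet> h b) *\<^sub>R b)" for x
  \<comment> \<open>\<open>Q x\<close> has, in the standard basis, the coordinates that \<open>g x\<close> has in \<open>B\<close>.\<close>
  define Q where "Q x = (\<Sum>b\<in>B. (g x \<bullet> b) *\<^sub>R h b)" for x
  have hh: "h a \<bullet> h b = (if a = b then 1 else 0)" if "a \<in> B" "b \<in> B" for a b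
    using that bij_betwE[OF h] bij_betw_imp_inj_on[OF h] by (simp add: inner_Basis inj_on_eq_iff)
  have Qh: "Q x \<bullet> h b = g x \<bullet> b" if "b \<in> B" for x b
    using that B(1) by (simp add: Q_def inner_sum_left hh if_distrib sum.delta cong: if_cong)
  have eQ: "e (Q x) = g x" for x
    using B(6)[of "g x"] by (simp add: e_def Qh)
  have "Q x \<bullet> Q y = (\<Sum>b\<in>B. (g x \<bullet> b) * (g y \<bullet> b))" for x y
    by (simp add: Q_def[of x] inner_sum_left inner_commute[of "h _" "Q y"] Qh)
  also have "(\<Sum>b\<in>B. (g x \<bullet> b) * (g y \<bullet> b)) = g x \<bullet> (\<Sum>b\<in>B. (g y \<bullet> b) *\<^sub>R b)" for x y
    by (simp add: inner_sum_right mult.commute)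
  also have "g x \<bullet> (\<Sum>b\<in>B. (g y \<bullet> b) *\<^sub>R b) = g x \<bullet> g y" for x y
    by (simp add: B(6))
  finally have QQ: "Q x \<bullet> Q y = g x \<bullet> g y" for x y .
  have linQ: "linear Q"
    unfolding Q_def
    by (intro linearI) (simp_all add: linear_add[OF lin] linear_scale[OF lin] inner_add_left
        scaleR_add_left sum.distrib scaleR_sum_right)
  have orthQ: "orthogonal_transformation Q"
    using linQ QQ iso by (simp add: orthogonal_transformation norm_eq_sqrt_inner)
  have contQ: "Q \<in> borel_measurable lborel"
    using borel_measurable_linear_euclidean[OF linQ] by simp
  have eU: "e x \<in> ?U" for x
    unfolding e_def using B(4) ob
    by (auto intro!: subspace_sum subspace_scale simp: orthonormal_basis_def span_base)
  have e: "e \<in> borel \<rightarrow>\<^sub>M ?R"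
    by (intro measurable_restrict_space2) (auto simp: eU, simp add: e_def[abs_def])
  have P: "(\<lambda>x. \<Sum>b\<in>B. x b *\<^sub>R b) \<in> (\<Pi>\<^sub>M b\<in>B. lborel) \<rightarrow>\<^sub>M ?R"
  proof (rule measurable_restrict_space2)
    show "(\<lambda>x. \<Sum>b\<in>B. x b *\<^sub>R b) \<in> space (\<Pi>\<^sub>M b\<in>B. lborel) \<rightarrow> ?U"
      using B(4) ob
      by (auto intro!: subspace_sum subspace_scale simp: orthonormal_basis_def span_base)
  qed measurable
  have "lborel_subspace ?U = distr (\<Pi>\<^sub>M b\<in>B. lborel) ?R (\<lambda>x. \<Sum>b\<in>B. x b *\<^sub>R b)"
    by (simp add: lborel_subspace_def B_def Let_def)
  also have "\<dots> = distr (distr lborel (\<Pi>\<^sub>M b\<in>B. lborel) (\<lambda>x. \<lambda>b\<in>B. x \<bullet> h b)) ?R (\<lambda>x. \<Sum>b\<in>B. x b *\<^sub>R b)"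
    by (simp only: distr_lborel_coordinates[OF h])
  also have "\<dots> = distr lborel ?R ((\<lambda>x. \<Sum>b\<in>B. x b *\<^sub>R b) \<circ> (\<lambda>x. \<lambda>b\<in>B. x \<bullet> h b))"
    by (intro distr_distr P measurable_restrict) simp
  also have "\<dots> = distr lborel ?R e"
    by (intro distr_cong) (auto simp: e_def)
  also have "\<dots> = distr (distr lborel borel Q) ?R e"
    by (simp only: lborel_distr_orthogonal_transformation[OF orthQ])
  also have "\<dots> = distr lborel ?R (e \<circ> Q)"
    using e contQ by (rule distr_distr)
  also have "e \<circ> Q = g"
    using eQ by (auto simp: fun_eq_iff)
  finally show ?thesis .
qed

text \<open>
  Both \<open>g\<close> and its inverse on \<open>range g\<close> are measure preserving for the Borel structures, and
  therefore also measurable for the completions.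
\<close>

lemma
  fixes g :: "real^'n::{finite,wellorder} \<Rightarrow> 'a::euclidean_space"
  assumes lin: "linear g" and iso: "\<And>x. norm (g x) = norm x"
  shows lebesgue_subspace_vimage_isometry:
      "S \<in> sets (lebesgue_subspace (range g)) \<Longrightarrow> g -` S \<in> sets lebesgue"
    and emeasure_lebesgue_subspace_image_isometry:
      "T \<in> sets lebesgue \<Longrightarrow> emeasure (lebesgue_subspace (range g)) (g ` T) = emeasure lebesgue T"
proof -
  let ?U = "range g"
  let ?R = "restrict_space borel ?U :: 'a measure"
  let ?M = "lborel_subspace ?U"
  have inj: "inj g"
    using lin iso by (rule inj_linear_isometry)
  then obtain g' where lin': "linear g'" and g': "g' \<circ> g = id"
    using linear_injective_left_inverse[OF lin] by blast
  have M: "?M = distr lborel ?R g"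
    using lin iso by (rule lborel_subspace_eq_distr)
  have sM: "sets ?M = sets ?R"
    by (simp add: M)
  have gR: "g \<in> lborel \<rightarrow>\<^sub>M ?R"
    using borel_measurable_linear_euclidean[OF lin] by (intro measurable_restrict_space2) auto
  then have g: "g \<in> lborel \<rightarrow>\<^sub>M ?M"
    using sM measurable_cong_sets by blast
  have "g' \<in> ?R \<rightarrow>\<^sub>M lborel"
    using borel_measurable_linear_euclidean[OF lin'] by (simp add: measurable_restrict_space1)
  then have g'M: "g' \<in> ?M \<rightarrow>\<^sub>M lborel"
    using sM measurable_cong_sets by blast
  have dg: "distr lborel ?M g = ?M"
    using M by (metis distr_cong sM)
  have dg': "distr ?M lborel g' = lborel"
  proof -
    have "distr ?M lborel g' = distr (distr lborel ?M g) lborel g'"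
      by (simp only: dg)
    also have "\<dots> = distr lborel lborel (g' \<circ> g)"
      using g'M g by (rule distr_distr)
    finally show ?thesis
      by (simp add: g' id_def distr_id2)
  qed
  have gg: "g \<in> lebesgue \<rightarrow>\<^sub>M completion ?M"
    using completion.measurable_completion2[OF measurable_completion[OF g]]
    by (simp add: distr_completion[OF g] dg)
  have gg': "g' \<in> completion ?M \<rightarrow>\<^sub>M lebesgue"
    using completion.measurable_completion2[OF measurable_completion[OF g'M]]
    by (simp add: distr_completion[OF g'M] dg')
  have dlg: "distr lebesgue (completion ?M) g = completion ?M"
    using completion.completion_distr_eq[OF measurable_completion[OF g]]
    by (simp add: distr_completion[OF g] dg)
  show "g -` S \<in> sets lebesgue" if "S \<in> sets (lebesgue_subspace ?U)"
    using measurable_sets[OF gg, of S] that by (simp add: lebesgue_subspace_def)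
  show "emeasure (lebesgue_subspace ?U) (g ` T) = emeasure lebesgue T"
    if T: "T \<in> sets lebesgue"
  proof -
    have "g ` T = g' -` T \<inter> space (completion ?M)"
      using g' by (auto simp: M space_restrict_space fun_eq_iff)
    then have gT: "g ` T \<in> sets (completion ?M)"
      using measurable_sets[OF gg' T] by simp
    have "emeasure (completion ?M) (g ` T) = emeasure lebesgue (g -` g ` T)"
      using emeasure_distr[OF gg gT] by (simp add: dlg)
    then show ?thesis
      using inj by (simp add: lebesgue_subspace_def inj_vimage_image_eq)
  qed
qed

text \<open>
  The case \<open>c = 0\<close> is included: then \<open>range f = {0}\<close>, and \<^const>\<open>subspace_vol\<close> is \<open>0\<close> because
  the dimensions disagree.
\<close>

lemma subspace_vol_image_similarity:
  fixes f :: "real^'n::{finite,wellorder} \<Rightarrow> 'a::euclidean_space"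
  assumes lin: "linear f" and sim: "\<And>x. norm (f x) = c * norm x" and "0 \<le> c"
    and T: "T \<in> sets lebesgue"
  shows "subspace_vol CARD('n) (range f) (f ` T) = ennreal (c ^ CARD('n)) * emeasure lebesgue T"
proof (cases "c = 0")
  case True
  then have "f x = 0" for x
    using sim[of x] by simp
  then have "range f = {0}"
    by auto
  then have "subspace_vol CARD('n) (range f) (f ` T) = 0"
    by (simp add: subspace_vol_def)
  with True show ?thesis by simp
next
  case False
  define g where "g x = (1 / c) *\<^sub>R f x" for x
  have ling: "linear g"
    using linear_compose_scale_right[OF lin, of "1 / c"] by (simp add: g_def[abs_def])
  have iso: "norm (g x) = norm x" for x
    using False \<open>0 \<le> c\<close> by (simp add: g_def sim)
  have fg: "f x = g (c *\<^sub>R x)" for x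
    using False by (simp add: g_def linear_scale[OF lin])
  have rng: "range f = range g"
  proof
    show "range f \<subseteq> range g" using fg by auto
    have "g x = f ((1 / c) *\<^sub>R x)" for x by (simp add: g_def linear_scale[OF lin])
    then show "range g \<subseteq> range f" by auto
  qed
  have "inj g"
    using ling iso by (rule inj_linear_isometry)
  then have dim: "dim (range f) = CARD('n)"
    using dim_image_eq[OF ling, of UNIV] rng by simp
  have cT: "(*\<^sub>R) c ` T \<in> sets lebesgue"
  proof -
    have "(*\<^sub>R) c ` T = (*\<^sub>R) (1 / c) -` T \<inter> space lebesgue"
      using False by (force simp: image_iff)
    then show ?thesis
      using measurable_sets[OF lebesgue_measurable_scaling T] by metis
  qed
  have "f ` T = g ` ((*\<^sub>R) c ` T)"
    using fg by (auto simp: image_image)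
  then have "subspace_vol CARD('n) (range f) (f ` T) = emeasure lebesgue ((*\<^sub>R) c ` T)"
    using emeasure_lebesgue_subspace_image_isometry[OF ling iso cT]
    by (simp add: subspace_vol_def dim rng[symmetric])
  also have "\<dots> = ennreal (c ^ CARD('n)) * emeasure lebesgue T"
    using emeasure_lebesgue_affine[of c "0::real^'n::_" T] \<open>0 \<le> c\<close>
    by (simp add: ennreal_power)
  finally show ?thesis .
qed

text \<open>
  The map \<open>P\<close> will be an orthogonal projection; only its composition with the parametrization
  \<open>g\<close> of the line matters.
\<close>

lemma subspace_vol_image_projection:
  fixes f g :: "real^'n::{finite,wellorder} \<Rightarrow> 'a::euclidean_space"
  assumes "linear g" "\<And>x. norm (g x) = norm x"
    and "linear f" "\<And>x. norm (f x) = c * norm x" "0 \<le> c"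
    and P: "\<And>x. P (g x) = f x" and S: "S \<in> sets (lebesgue_subspace (range g))"
  shows "subspace_vol CARD('n) (P ` range g) (P ` S)
    = ennreal (c ^ CARD('n)) * subspace_vol CARD('n) (range g) S"
proof -
  define T where "T = g -` S"
  have T: "T \<in> sets lebesgue"
    unfolding T_def using assms(1,2) S by (rule lebesgue_subspace_vimage_isometry)
  have ST: "S = g ` T"
    using sets.sets_into_space[OF S] by (auto simp: T_def)
  have "subspace_vol CARD('n) (P ` range g) (P ` S) = subspace_vol CARD('n) (range f) (f ` T)"
    by (simp add: ST image_image P)
  also have "\<dots> = ennreal (c ^ CARD('n)) * emeasure lebesgue T"
    using assms(3-5) T by (rule subspace_vol_image_similarity)
  also have "emeasure lebesgue T = subspace_vol CARD('n) (range g) S"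
    using subspace_vol_image_similarity[of g 1 T] assms(1,2) T by (simp add: ST)
  finally show ?thesis .
qed

section \<open>Orthogonal projections and Pythagoras\<close>

lemma real_orth_proj_eqI:
  assumes "subspace V" "y \<in> V" "\<And>v. v \<in> V \<Longrightarrow> (x - y) \<bullet> v = 0"
  shows "real_orth_proj V x = y"
  unfolding real_orth_proj_def
proof (rule the_equality)
  fix z assume z: "z \<in> V \<and> (\<forall>v\<in>V. (x - z) \<bullet> v = 0)"
  have "y - z \<in> V"
    using assms z by (simp add: subspace_diff)
  then have "(x - z) \<bullet> (y - z) = 0" "(x - y) \<bullet> (y - z) = 0"
    using assms z by blast+
  then have "(y - z) \<bullet> (y - z) = 0"
    by (simp add: inner_diff_left)
  then show "z = y" by simp
qed (use assms in auto)

lemma complex_subspace_imp_subspace: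
  fixes V :: "'a::complex_euclidean_space set"
  assumes "complex_vector.subspace V"
  shows "subspace V"
  using assms by (auto simp: subspace_def complex_vector.subspace_def scaleR_scaleC)

lemma cinner_scaleC_right: "cinner x (c *\<^sub>C y) = cnj c * cinner x y"
proof -
  have "cinner x (c *\<^sub>C y) = cnj (cinner (c *\<^sub>C y) x)" by (rule cinner_commute)
  also have "\<dots> = cnj c * cinner x y"
    by (simp add: cinner_scaleC_left cinner_commute[of x y])
  finally show ?thesis .
qed

text \<open>
  A complex subspace contains \<open>\<i> *\<^sub>C v\<close> with \<open>v\<close>, and the real inner product with
  \<open>\<i> *\<^sub>C v\<close> is the imaginary part of the Hermitian product with \<open>v\<close>.  Thus real and complex
  orthogonality to the subspace agree, and the complex projections are the real ones.
\<close>

lemma complex_orthogonal_iff_inner: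
  fixes V :: "'a::complex_euclidean_space set"
  assumes "complex_vector.subspace V"
  shows "(\<forall>v\<in>V. cinner x v = 0) \<longleftrightarrow> (\<forall>v\<in>V. x \<bullet> v = 0)"
proof
  assume 0: "\<forall>v\<in>V. x \<bullet> v = 0"
  show "\<forall>v\<in>V. cinner x v = 0"
  proof
    fix v assume "v \<in> V"
    moreover from this have "\<i> *\<^sub>C v \<in> V"
      using assms by (simp add: complex_vector.subspace_def)
    ultimately have "x \<bullet> v = 0" "x \<bullet> (\<i> *\<^sub>C v) = 0"
      using 0 by auto
    then show "cinner x v = 0"
      by (simp add: inner_eq_Re_cinner cinner_scaleC_right complex_eq_iff)
  qed
qed (simp add: inner_eq_Re_cinner)

lemma complex_orth_proj_eq_real_orth_proj:
  assumes "complex_vector.subspace V"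
  shows "complex_orth_proj V = real_orth_proj V"
  by (simp add: fun_eq_iff complex_orth_proj_def real_orth_proj_def
      complex_orthogonal_iff_inner[OF assms])

lemma complex_orth_partition_imp_real:
  assumes "complex_orth_partition k V"
  shows "real_orth_partition k V"
  using assms unfolding complex_orth_partition_def real_orth_partition_def
  by (simp add: complex_subspace_imp_subspace inner_eq_Re_cinner)

lemma
  assumes "real_orth_partition k V"
  shows real_orth_proj_in: "j \<in> {1..k} \<Longrightarrow> real_orth_proj (V j) x \<in> V j"
    and real_orth_proj_orthogonal:
      "j \<in> {1..k} \<Longrightarrow> w \<in> V j \<Longrightarrow> (x - real_orth_proj (V j) x) \<bullet> w = 0"
    and sum_norm_real_orth_proj: "(\<Sum>j=1..k. (norm (real_orth_proj (V j) x))\<^sup>2) = (norm x)\<^sup>2"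
proof -
  have sub: "\<And>j. j \<in> {1..k} \<Longrightarrow> subspace (V j)"
    and orth: "\<And>i j a b. i \<in> {1..k} \<Longrightarrow> j \<in> {1..k} \<Longrightarrow> i \<noteq> j \<Longrightarrow> a \<in> V i \<Longrightarrow> b \<in> V j \<Longrightarrow> a \<bullet> b = 0"
    and ex: "\<exists>v. v \<in> Pi\<^sub>E {1..k} V \<and> x = (\<Sum>j=1..k. v j)"
    using assms unfolding real_orth_partition_def by blast+
  from ex obtain v where v: "v \<in> Pi\<^sub>E {1..k} V" and x: "x = (\<Sum>j=1..k. v j)"
    by blast
  have vj: "v j \<in> V j" if "j \<in> {1..k}" for j
    using v that by (rule PiE_mem)
  have xw: "x \<bullet> w = v j \<bullet> w" if j: "j \<in> {1..k}" and w: "w \<in> V j" for j w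
  proof -
    have "x \<bullet> w = (\<Sum>i=1..k. v i \<bullet> w)"
      by (simp add: x inner_sum_left)
    also have "\<dots> = (\<Sum>i=1..k. if i = j then v j \<bullet> w else 0)"
      using orth[OF _ j _ vj w] by (intro sum.cong) auto
    finally show ?thesis using j by simp
  qed
  \<comment> \<open>The projections are the components of \<open>x\<close> in the orthogonal direct sum.\<close>
  have proj: "real_orth_proj (V j) x = v j" if "j \<in> {1..k}" for j
    using that sub vj xw by (intro real_orth_proj_eqI) (auto simp: inner_diff_left)
  show "real_orth_proj (V j) x \<in> V j" if "j \<in> {1..k}"
    using that by (simp only: proj vj)
  show "(x - real_orth_proj (V j) x) \<bullet> w = 0" if "j \<in> {1..k}" "w \<in> V j"
    using that by (simp add: proj xw inner_diff_left)
  have "(norm x)\<^sup>2 = (\<Sum>j=1..k. x \<bullet> v j)"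
    unfolding power2_norm_eq_inner by (subst (2) x) (rule inner_sum_right)
  also have "\<dots> = (\<Sum>j=1..k. (norm (v j))\<^sup>2)"
    by (intro sum.cong refl) (simp add: xw vj power2_norm_eq_inner)
  finally show "(\<Sum>j=1..k. (norm (real_orth_proj (V j) x))\<^sup>2) = (norm x)\<^sup>2"
    by (simp add: proj)
qed

lemma real_orth_proj_scaleR:
  assumes "real_orth_partition k V" "j \<in> {1..k}"
  shows "real_orth_proj (V j) (c *\<^sub>R x) = c *\<^sub>R real_orth_proj (V j) x"
proof (rule real_orth_proj_eqI)
  show sub: "subspace (V j)"
    using assms by (simp add: real_orth_partition_def)
  show "c *\<^sub>R real_orth_proj (V j) x \<in> V j"
    using sub real_orth_proj_in[OF assms] by (rule subspace_scale)
  show "(c *\<^sub>R x - c *\<^sub>R real_orth_proj (V j) x) \<bullet> v = 0" if "v \<in> V j" for v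
    using real_orth_proj_orthogonal[OF assms that, of x]
    by (simp flip: scaleR_diff_right)
qed

lemma complex_orth_proj_scaleC:
  fixes V :: "nat \<Rightarrow> 'a::complex_euclidean_space set"
  assumes V: "complex_orth_partition k V" and j: "j \<in> {1..k}"
  shows "complex_orth_proj (V j) (c *\<^sub>C x) = c *\<^sub>C complex_orth_proj (V j) x"
proof -
  have sub: "complex_vector.subspace (V j)"
    using V j by (simp add: complex_orth_partition_def)
  note R = complex_orth_partition_imp_real[OF V]
  let ?p = "real_orth_proj (V j) x"
  have "real_orth_proj (V j) (c *\<^sub>C x) = c *\<^sub>C ?p"
  proof (rule real_orth_proj_eqI)
    show "subspace (V j)"
      using sub by (rule complex_subspace_imp_subspace)
    show "c *\<^sub>C ?p \<in> V j"
      using sub real_orth_proj_in[OF R j] by (simp add: complex_vector.subspace_def)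
    have "\<forall>v\<in>V j. cinner (x - ?p) v = 0"
      using complex_orthogonal_iff_inner[OF sub] real_orth_proj_orthogonal[OF R j] by blast
    then show "(c *\<^sub>C x - c *\<^sub>C ?p) \<bullet> v = 0" if "v \<in> V j" for v
      using that
      by (simp add: inner_eq_Re_cinner cinner_scaleC_left flip: complex_vector.scale_right_diff_distrib)
  qed
  then show ?thesis
    by (simp add: complex_orth_proj_eq_real_orth_proj[OF sub])
qed

lemma norm_scaleC: "norm (c *\<^sub>C x) = norm c * norm (x :: 'a::complex_euclidean_space)"
proof -
  have "complex_of_real ((norm (c *\<^sub>C x))\<^sup>2) = c * cnj c * complex_of_real ((norm x)\<^sup>2)"
    unfolding power2_norm_eq_inner cinner_self[symmetric]
    by (simp add: cinner_scaleC_left cinner_scaleC_right)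
  also have "\<dots> = complex_of_real ((norm c * norm x)\<^sup>2)"
    by (simp add: complex_norm_square[symmetric] power_mult_distrib)
  finally have "(norm (c *\<^sub>C x))\<^sup>2 = (norm c * norm x)\<^sup>2"
    by (simp only: of_real_eq_iff)
  then show ?thesis by simp
qed

section \<open>Parametrization of lines by a unit vector\<close>

lemma real_line_unit_vector:
  assumes "real_line L"
  obtains u where "norm u = 1" "L = range (\<lambda>t. t *\<^sub>R u)"
proof -
  obtain B where B: "orthonormal_basis L B"
    using assms orthonormal_basis_exists by (auto simp: real_line_def)
  then have "card B = 1"
    using assms orthonormal_basis_facts(3)[OF B] by (simp add: real_line_def)
  then obtain u where "B = {u}"
    by (rule card_1_singletonE)
  with B have "norm u = 1" "L = range (\<lambda>t. t *\<^sub>R u)"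
    by (auto simp: orthonormal_basis_def span_singleton)
  then show ?thesis by (rule that)
qed

lemma complex_line_unit_vector:
  fixes L :: "'a::complex_euclidean_space set"
  assumes "complex_line L"
  obtains u where "norm u = 1" "L = range (\<lambda>c. c *\<^sub>C u)"
proof -
  have L: "complex_vector.subspace L" "complex_vector.dim L = 1"
    using assms by (auto simp: complex_line_def)
  obtain B where B: "B \<subseteq> L" "complex_vector.independent B" "L \<subseteq> complex_vector.span B" "card B = 1"
    using complex_vector.basis_exists[of L] L(2) by metis
  then obtain w where w: "B = {w}"
    using card_1_singletonE by blast
  have "w \<noteq> 0"
    using B(2) w by (auto simp: complex_vector.dependent_zero)
  have Lw: "L = range (\<lambda>c. c *\<^sub>C w)"
    using B(1,3) L(1) w by (auto simp: complex_vector.span_singleton complex_vector.subspace_def)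
  define r where "r = complex_of_real (norm w)"
  define u where "u = inverse r *\<^sub>C w"
  have r: "r \<noteq> 0" "norm r = norm w"
    using \<open>w \<noteq> 0\<close> by (auto simp: r_def)
  have "norm u = 1"
    using r \<open>w \<noteq> 0\<close> by (simp add: u_def norm_scaleC norm_inverse)
  moreover have "c *\<^sub>C w = (c * r) *\<^sub>C u" for c
    using r by (simp add: u_def)
  then have "L \<subseteq> range (\<lambda>c. c *\<^sub>C u)"
    using Lw by auto
  then have "L = range (\<lambda>c. c *\<^sub>C u)"
    using Lw by (auto simp: u_def)
  ultimately show ?thesis by (rule that)
qed

text \<open>
  The real multiples of \<open>w\<close>, parametrized by \<open>\<real>\<^sup>1\<close>.
\<close>

definition real_axis_map :: "'a::euclidean_space \<Rightarrow> real^1 \<Rightarrow> 'a"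
  where "real_axis_map w x = x $ 1 *\<^sub>R w"

text \<open>
  The complex multiples of \<open>w\<close>, parametrized by \<open>\<real>\<^sup>2\<close> through the real and imaginary parts of
  the scalar.
\<close>

definition complex_axis_map :: "'a::complex_euclidean_space \<Rightarrow> real^2 \<Rightarrow> 'a"
  where "complex_axis_map w x = Complex (x $ 1) (x $ 2) *\<^sub>C w"

lemma linear_real_axis_map: "linear (real_axis_map w)"
  by (intro linearI) (simp_all add: real_axis_map_def algebra_simps)

lemma norm_real_axis_map: "norm (real_axis_map w x) = norm w * norm x"
  by (simp add: real_axis_map_def norm_real)

lemma range_real_axis_map: "range (real_axis_map w) = range (\<lambda>t. t *\<^sub>R w)"
proof -
  have "t *\<^sub>R w = real_axis_map w (vec t)" for t
    by (simp add: real_axis_map_def)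
  then have "range (\<lambda>t. t *\<^sub>R w) \<subseteq> range (real_axis_map w)"
    by auto
  then show ?thesis
    by (auto simp: real_axis_map_def)
qed

lemma linear_complex_axis_map: "linear (complex_axis_map w)"
proof (rule linearI)
  show "complex_axis_map w (x + y) = complex_axis_map w x + complex_axis_map w y" for x y
    by (simp add: complex_axis_map_def complex_add flip: scaleC_add_left)
  have "Complex (r * a) (r * b) = complex_of_real r * Complex a b" for r a b
    by (simp add: complex_eq_iff)
  then show "complex_axis_map w (r *\<^sub>R x) = r *\<^sub>R complex_axis_map w x" for r x
    by (simp add: complex_axis_map_def scaleR_scaleC)
qed

lemma norm_complex_axis_map: "norm (complex_axis_map w x) = norm w * norm x"
  by (simp add: complex_axis_map_def norm_scaleC cmod_def norm_vec_def L2_set_def sum_2)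

lemma range_complex_axis_map: "range (complex_axis_map w) = range (\<lambda>c. c *\<^sub>C w)"
proof -
  have "c *\<^sub>C w = complex_axis_map w (vector [Re c, Im c])" for c
    by (simp add: complex_axis_map_def vector_2)
  then have "range (\<lambda>c. c *\<^sub>C w) \<subseteq> range (complex_axis_map w)"
    by auto
  then show ?thesis
    by (auto simp: complex_axis_map_def)
qed

section \<open>The measure of a subset of a line and of its projections\<close>

theorem theorem3p2:
  "(\<forall>(L :: 'a::euclidean_space set) k V S.
      real_line L \<longrightarrow> real_orth_partition k V \<longrightarrow> S \<in> sets (lebesgue_subspace L) \<longrightarrow>
      (subspace_vol 1 L S)\<^sup>2 =
        (\<Sum>j=1..k. (subspace_vol 1 (real_orth_proj (V j) ` L) (real_orth_proj (V j) ` S))\<^sup>2))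
   \<and>
   (\<forall>(L :: 'b::complex_euclidean_space set) k V S.
      complex_line L \<longrightarrow> complex_orth_partition k V \<longrightarrow> S \<in> sets (lebesgue_subspace L) \<longrightarrow>
      subspace_vol 2 L S =
        (\<Sum>j=1..k. subspace_vol 2 (complex_orth_proj (V j) ` L) (complex_orth_proj (V j) ` S)))"
proof (intro conjI allI impI)
  fix L :: "'a set" and k and V :: "nat \<Rightarrow> 'a set" and S
  assume L: "real_line L" and V: "real_orth_partition k V" and S: "S \<in> sets (lebesgue_subspace L)"
  from L obtain u where u: "norm u = 1" and Lu: "L = range (real_axis_map u)"
    unfolding range_real_axis_map by (rule real_line_unit_vector)
  define c where "c j = norm (real_orth_proj (V j) u)" for j
  have *: "subspace_vol 1 (real_orth_proj (V j) ` L) (real_orth_proj (V j) ` S)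
      = ennreal (c j) * subspace_vol 1 L S" if j: "j \<in> {1..k}" for j
  proof -
    have "real_orth_proj (V j) (real_axis_map u x) = real_axis_map (real_orth_proj (V j) u) x" for x
      using real_orth_proj_scaleR[OF V j] by (simp add: real_axis_map_def)
    then show ?thesis
      using subspace_vol_image_projection[OF linear_real_axis_map[of u] _
          linear_real_axis_map[of "real_orth_proj (V j) u"] norm_real_axis_map norm_ge_zero,
          of "real_orth_proj (V j)" S] u S
      by (simp add: norm_real_axis_map Lu c_def)
  qed
  have "(\<Sum>j=1..k. (subspace_vol 1 (real_orth_proj (V j) ` L) (real_orth_proj (V j) ` S))\<^sup>2)
      = (\<Sum>j=1..k. ennreal ((c j)\<^sup>2) * (subspace_vol 1 L S)\<^sup>2)"
    by (intro sum.cong refl) (simp only: *, simp add: power_mult_distrib ennreal_power c_def)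
  also have "\<dots> = ennreal (\<Sum>j=1..k. (c j)\<^sup>2) * (subspace_vol 1 L S)\<^sup>2"
    by (simp add: sum_ennreal flip: sum_distrib_right)
  also have "(\<Sum>j=1..k. (c j)\<^sup>2) = 1"
    using sum_norm_real_orth_proj[OF V, of u] u by (simp add: c_def)
  finally show "(subspace_vol 1 L S)\<^sup>2 =
      (\<Sum>j=1..k. (subspace_vol 1 (real_orth_proj (V j) ` L) (real_orth_proj (V j) ` S))\<^sup>2)"
    by simp
next
  fix L :: "'b set" and k and V :: "nat \<Rightarrow> 'b set" and S
  assume L: "complex_line L" and V: "complex_orth_partition k V"
    and S: "S \<in> sets (lebesgue_subspace L)"
  from L obtain u where u: "norm u = 1" and Lu: "L = range (complex_axis_map u)"
    unfolding range_complex_axis_map by (rule complex_line_unit_vector)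
  define c where "c j = norm (complex_orth_proj (V j) u)" for j
  have *: "subspace_vol 2 (complex_orth_proj (V j) ` L) (complex_orth_proj (V j) ` S)
      = ennreal ((c j)\<^sup>2) * subspace_vol 2 L S" if j: "j \<in> {1..k}" for j
  proof -
    have "complex_orth_proj (V j) (complex_axis_map u x)
        = complex_axis_map (complex_orth_proj (V j) u) x" for x
      using complex_orth_proj_scaleC[OF V j] by (simp add: complex_axis_map_def)
    then show ?thesis
      using subspace_vol_image_projection[OF linear_complex_axis_map[of u] _
          linear_complex_axis_map[of "complex_orth_proj (V j) u"] norm_complex_axis_map norm_ge_zero,
          of "complex_orth_proj (V j)" S] u S
      by (simp add: norm_complex_axis_map Lu c_def)
  qed
  have c: "c j = norm (real_orth_proj (V j) u)" if "j \<in> {1..k}" for j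
    using V that by (simp add: c_def complex_orth_partition_def complex_orth_proj_eq_real_orth_proj)
  have "(\<Sum>j=1..k. subspace_vol 2 (complex_orth_proj (V j) ` L) (complex_orth_proj (V j) ` S))
      = ennreal (\<Sum>j=1..k. (c j)\<^sup>2) * subspace_vol 2 L S"
    by (simp add: * sum_ennreal flip: sum_distrib_right)
  also have "(\<Sum>j=1..k. (c j)\<^sup>2) = 1"
    using sum_norm_real_orth_proj[OF complex_orth_partition_imp_real[OF V], of u] u by (simp add: c)
  finally show "subspace_vol 2 L S =
      (\<Sum>j=1..k. subspace_vol 2 (complex_orth_proj (V j) ` L) (complex_orth_proj (V j) ` S))"
    by simp
qed

end
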